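(* Let $n\ge 1$ and let $(\xi_i,\mathfrak{F}_i)_{i=0,\dots,n}$ be a sequence of square integrable real-valued martingale differences with $\xi_0=0$ and $\mathfrak F_0$ trivial, and let $S_n=\sum_{i=1}^n\xi_i$. For $x,y\ge 0$ put \[ f(x,y)=\frac{xy(\ln (xy+1)-1)+\ln (xy+1)}{y^2}\quad (y>0),\qquad f(x,0)=\frac{x^2}{2}. \] Then for all $x,y\ge 0$, \[ \mathbb{P}\Big(\frac{S_n}{B_n(y)} \geq x\Big) \leq\inf_{p>1}\Big(\mathbb{E}\big[\exp\big\{-(p-1)f(x,y)B_n(y)\big\}1_{\{S_n\geq xB_n(y)\}}\big]\Big)^{1/p} \] \[ \leq \inf_{p>1}\Big(\mathbb{E}\Big[\exp\Big\{-(p-1)\frac{x^2}{2(1+xy/3)}B_n(y)\Big\}1_{\{S_n\geq xB_n(y)\}}\Big]\Big)^{1/p}, \] and consequently, for all $x,y\ge 0$, \[ \mathbb{P}\Big(\frac{S_n}{B_n(y)}\geq x\Big) \leq\inf_{p>1}\Big(\mathbb{E}\Big[\exp\Big\{-(p-1)\frac{x^2}{2(1+xy/3)}B_n(y)\Big\}\Big]\Big)^{1/p}. \] Moreover, for all $x,y,z>0$, \[ \mathbb{P}\Big(\frac{S_n}{B_n(y)}\geq x,\ B_n(y)\geq z\Big) \leq \exp\Big\{-\frac{x^2z}{2(1+\frac{xy}{3})}\Big\}. \]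
   Context: $(\Omega,\mathfrak F,\mathbb P)$ is a probability space with increasing $\sigma$-fields $\{\emptyset,\Omega\}=\mathfrak F_0\subseteq\cdots\subseteq\mathfrak F_n\subseteq\mathfrak F$; each $\xi_i$ is $\mathfrak F_i$-measurable, $\mathbb E[\xi_i\mid\mathfrak F_{i-1}]=0$ and $\mathbb E[\xi_i^2]<\infty$ for $i\ge1$. For $y\ge 0$, \[[S]_n(y)=\sum_{i=1}^{n}\xi_i^2 1_{\{\xi_i>y\}},\qquad \langle S\rangle_n(y)=\sum_{i=1}^{n}\mathbb{E}[\xi_i^21_{\{\xi_i\leq y\}}|\mathfrak{F}_{i-1}],\qquad B_n(y)=[S]_n(y)+\langle S\rangle_n(y).\] *)

theory Defs
  imports "HOL-Probability.Probability"
begin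

text \<open>Only the indices \<open>0, ..., n\<close> of \<open>F\<close> and \<open>\<xi>\<close> are constrained. Integrability of each
  \<open>\<xi> i\<close> is not listed because it follows from square integrability on a probability space.\<close>

definition sq_int_mart_diff ::
    "'a measure \<Rightarrow> (nat \<Rightarrow> 'a measure) \<Rightarrow> nat \<Rightarrow> (nat \<Rightarrow> 'a \<Rightarrow> real) \<Rightarrow> bool" where
  "sq_int_mart_diff M F n \<xi> \<longleftrightarrow>
     prob_space M \<and>
     (\<forall>i\<le>n. subalgebra M (F i)) \<and>
     (\<forall>i j. i \<le> j \<and> j \<le> n \<longrightarrow> subalgebra (F j) (F i)) \<and>
     sets (F 0) = {{}, space M} \<and>
     (\<forall>i\<le>n. \<xi> i \<in> borel_measurable (F i)) \<and>
     (\<forall>\<omega>\<in>space M. \<xi> 0 \<omega> = 0) \<and>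
     (\<forall>i\<in>{1..n}. integrable M (\<lambda>\<omega>. (\<xi> i \<omega>)\<^sup>2)) \<and>
     (\<forall>i\<in>{1..n}. AE \<omega> in M. real_cond_exp M (F (i - 1)) (\<xi> i) \<omega> = 0)"

definition mart_sum :: "(nat \<Rightarrow> 'a \<Rightarrow> real) \<Rightarrow> nat \<Rightarrow> 'a \<Rightarrow> real" where
  "mart_sum \<xi> n \<omega> = (\<Sum>i=1..n. \<xi> i \<omega>)"

definition sq_bracket :: "(nat \<Rightarrow> 'a \<Rightarrow> real) \<Rightarrow> nat \<Rightarrow> real \<Rightarrow> 'a \<Rightarrow> real" where
  "sq_bracket \<xi> n y \<omega> = (\<Sum>i=1..n. (\<xi> i \<omega>)\<^sup>2 * indicator {\<omega>'. \<xi> i \<omega>' > y} \<omega>)"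

definition angle_bracket ::
    "'a measure \<Rightarrow> (nat \<Rightarrow> 'a measure) \<Rightarrow> (nat \<Rightarrow> 'a \<Rightarrow> real) \<Rightarrow> nat \<Rightarrow> real \<Rightarrow> 'a \<Rightarrow> real" where
  "angle_bracket M F \<xi> n y \<omega> =
     (\<Sum>i=1..n. real_cond_exp M (F (i - 1))
                  (\<lambda>\<omega>. (\<xi> i \<omega>)\<^sup>2 * indicator {\<omega>'. \<xi> i \<omega>' \<le> y} \<omega>) \<omega>)"

text \<open>This is \<open>B\<^sub>n(y)\<close>. The ratio \<open>S\<^sub>n / B\<^sub>n(y)\<close> uses HOL's division, hence the convention
  \<open>0 / 0 = 0\<close>; almost surely, \<open>B\<^sub>n(y) = 0\<close> only occurs together with \<open>S\<^sub>n = 0\<close>. As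
  \<open>real_cond_exp\<close> is a fixed version of the conditional expectation, \<open>B\<^sub>n(y) \<ge> 0\<close> holds only almost
  surely.\<close>

definition var_B ::
    "'a measure \<Rightarrow> (nat \<Rightarrow> 'a measure) \<Rightarrow> (nat \<Rightarrow> 'a \<Rightarrow> real) \<Rightarrow> nat \<Rightarrow> real \<Rightarrow> 'a \<Rightarrow> real" where
  "var_B M F \<xi> n y \<omega> = sq_bracket \<xi> n y \<omega> + angle_bracket M F \<xi> n y \<omega>"

definition rate_f :: "real \<Rightarrow> real \<Rightarrow> real" where
  "rate_f x y = (if y = 0 then x\<^sup>2 / 2
            else (x * y * (ln (x * y + 1) - 1) + ln (x * y + 1)) / y\<^sup>2)"

end

theory Submission
  imports Defs
begin

text \<open>The self-normalised bound rests on one exponential supermartingale. For \<open>l \<ge> 0\<close> let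
  \<open>c = jump_comp y l\<close>, which is \<open>(exp (l y) - 1 - l y) / y\<^sup>2\<close> for \<open>y > 0\<close>. The pointwise inequality
  \<open>exp (l t - c t\<^sup>2 1{t > y}) \<le> 1 + l t + c t\<^sup>2 1{t \<le> y}\<close> (\<open>exp_jump_le\<close>) shows that
  \<open>exp (l S\<^sub>k - c B\<^sub>k(y))\<close> is a supermartingale: the linear term has conditional mean zero, and the
  quadratic one is compensated by the predictable bracket. Hence
  \<open>T = l S\<^sub>n - c B\<^sub>n(y)\<close> satisfies \<open>E exp T \<le> 1\<close> (\<open>exp_mart_le_one\<close>).

  On the event \<open>S\<^sub>n \<ge> x B\<^sub>n(y)\<close> the exponent \<open>T\<close> is at least \<open>(l x - c) B\<^sub>n(y)\<close>, and the best choice of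
  \<open>l\<close> turns \<open>l x - c\<close> into the rate \<open>f(x,y)\<close> (\<open>rate_f_attained\<close>). A convexity argument
  (\<open>prob_le_exp_moment_powr\<close>) converts \<open>E exp T \<le> 1\<close> into a bound on the probability of the event by
  the moment of \<open>exp (- (p - 1) f(x,y) B\<^sub>n(y))\<close> over it. The comparison of Bennett's rate with Bernstein's
  (\<open>rate_f_ge_bernstein\<close>) gives the weaker explicit bounds, and Markov's inequality for \<open>exp T\<close> gives
  the bound on the event \<open>B\<^sub>n(y) \<ge> z\<close>.\<close>

section \<open>Bennett's function and its Legendre transform\<close>

lemma exp_le_quadratic_nonpos:
  fixes u :: real
  assumes "u \<le> 0"
  shows "exp u \<le> 1 + u + u\<^sup>2 / 2"
proof -
  let ?f = "\<lambda>u::real. exp u - (1 + u + u\<^sup>2 / 2)"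
  have "?f u \<le> ?f 0"
  proof (rule DERIV_nonneg_imp_nondecreasing[OF assms])
    fix t :: real
    have "(?f has_real_derivative exp t - (1 + t)) (at t)"
      by (auto intro!: derivative_eq_intros)
    moreover have "0 \<le> exp t - (1 + t)"
      using exp_ge_add_one_self[of t] by linarith
    ultimately show "\<exists>z. (?f has_real_derivative z) (at t) \<and> 0 \<le> z" by blast
  qed
  then show ?thesis by simp
qed

text \<open>This says that \<open>u \<mapsto> (exp u - 1 - u) / u\<^sup>2\<close> is nondecreasing. For
  \<open>u > 0\<close> every term of its power series is; for \<open>u \<le> 0\<close> the value at \<open>u\<close> is at most \<open>1/2\<close>
  and the value at \<open>v\<close> is at least \<open>1/2\<close>. The cleared denominators admit \<open>u = 0\<close> and \<open>v = 0\<close>.\<close>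
lemma exp_excess_mono:
  fixes u v :: real
  assumes "u \<le> v" "0 \<le> v"
  shows "(exp u - 1 - u) * v\<^sup>2 \<le> (exp v - 1 - v) * u\<^sup>2"
proof (cases "u \<le> 0")
  case True
  have "(exp u - 1 - u) * v\<^sup>2 \<le> u\<^sup>2 / 2 * v\<^sup>2"
    by (rule mult_right_mono) (use exp_le_quadratic_nonpos[OF True] in auto)
  also have "\<dots> = v\<^sup>2 / 2 * u\<^sup>2" by simp
  also have "\<dots> \<le> (exp v - 1 - v) * u\<^sup>2"
    by (rule mult_right_mono) (use exp_lower_Taylor_quadratic[OF assms(2)] in auto)
  finally show ?thesis .
next
  case False
  define a where "a = (\<lambda>(t::real) n. inverse (fact (n + 2)) * t ^ (n + 2))"
  have sums: "a t sums (exp t - 1 - t)" for t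
  proof -
    have "(\<lambda>n. inverse (fact n) * t ^ n) sums exp t"
      using exp_converges[of t] by simp
    then have "(\<lambda>n. inverse (fact (n + 2)) * t ^ (n + 2)) sums
        (exp t - (\<Sum>i<2. inverse (fact i) * t ^ i))"
      by (subst sums_iff_shift) simp
    then show ?thesis by (simp add: a_def numeral_2_eq_2 algebra_simps)
  qed
  have "a u n * v\<^sup>2 \<le> a v n * u\<^sup>2" for n
  proof -
    have "u ^ n \<le> v ^ n" using False assms by (intro power_mono) auto
    then have "u ^ n * (inverse (fact (n + 2)) * u\<^sup>2 * v\<^sup>2) \<le> v ^ n * (inverse (fact (n + 2)) * u\<^sup>2 * v\<^sup>2)"
      by (rule mult_right_mono) simp
    moreover have "a s n * t\<^sup>2 = s ^ n * (inverse (fact (n + 2)) * s\<^sup>2 * t\<^sup>2)" for s t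
      unfolding a_def power_add by (simp only: mult_ac)
    ultimately show ?thesis by (simp only: mult_ac)
  qed
  then show ?thesis
    by (rule sums_le) (rule sums_mult2[OF sums])+
qed

lemma exp_minus_half_square_le:
  fixes u :: real
  assumes "0 \<le> u"
  shows "exp (u - u\<^sup>2 / 2) \<le> 1 + u"
proof -
  let ?f = "\<lambda>u::real. ln (1 + u) - (u - u\<^sup>2 / 2)"
  have "?f 0 \<le> ?f u"
  proof (rule DERIV_nonneg_imp_nondecreasing[OF assms])
    fix t :: real
    assume t: "0 \<le> t"
    have "(?f has_real_derivative 1 / (1 + t) - (1 - t)) (at t)"
      using t by (auto intro!: derivative_eq_intros)
    moreover have "0 \<le> 1 / (1 + t) - (1 - t)"
      using t by (simp add: field_simps)
    ultimately show "\<exists>z. (?f has_real_derivative z) (at t) \<and> 0 \<le> z" by blast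
  qed
  then have "exp (u - u\<^sup>2 / 2) \<le> exp (ln (1 + u))" by simp
  then show ?thesis using assms by simp
qed

text \<open>Bennett's function. For \<open>y > 0\<close> and \<open>l \<ge> 0\<close> it is the smallest \<open>c\<close> with
  \<open>exp (l t) \<le> 1 + l t + c t\<^sup>2\<close> for all \<open>t \<le> y\<close>, and the value at \<open>y = 0\<close> is the limit.\<close>
definition jump_comp :: "real \<Rightarrow> real \<Rightarrow> real" where
  "jump_comp y l = (if y = 0 then l\<^sup>2 / 2 else (exp (l * y) - 1 - l * y) / y\<^sup>2)"

lemma jump_comp_ge:
  assumes "0 \<le> y" "0 \<le> l"
  shows "l\<^sup>2 / 2 \<le> jump_comp y l"
proof (cases "y = 0")
  case False
  have "l\<^sup>2 / 2 * y\<^sup>2 \<le> exp (l * y) - 1 - l * y"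
    using exp_lower_Taylor_quadratic[of "l * y"] assms by (simp add: power_mult_distrib)
  then show ?thesis using False by (simp add: jump_comp_def field_simps)
qed (simp add: jump_comp_def)

text \<open>The pointwise estimate that turns \<open>B\<^sub>n(y)\<close> into a compensator. A jump
  \<open>t \<le> y\<close> is treated as in Bennett's inequality and leaves a second-order term, whose conditional
  expectation goes into the predictable bracket. A jump \<open>t > y\<close> pays for itself: subtracting
  \<open>c t\<^sup>2 \<ge> (l t)\<^sup>2 / 2\<close> in the exponent already brings the exponential below its tangent
  \<open>1 + l t\<close>.\<close>
lemma exp_jump_le:
  assumes "0 \<le> y" "0 \<le> l"
  shows "exp (l * t - jump_comp y l * (t\<^sup>2 * indicator {y<..} t))
      \<le> 1 + l * t + jump_comp y l * (t\<^sup>2 * indicator {..y} t)"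
proof (cases "t \<le> y")
  case True
  have "exp (l * t) - 1 - l * t \<le> jump_comp y l * t\<^sup>2"
  proof (cases "y = 0 \<or> l = 0")
    case True
    with \<open>t \<le> y\<close> assms show ?thesis
      using exp_le_quadratic_nonpos[of "l * t"]
      by (auto simp: jump_comp_def power_mult_distrib mult_nonneg_nonpos)
  next
    case False
    then have "0 < l\<^sup>2" by simp
    have "(exp (l * t) - 1 - l * t) * (l * y)\<^sup>2 \<le> (exp (l * y) - 1 - l * y) * (l * t)\<^sup>2"
      using assms \<open>t \<le> y\<close> by (intro exp_excess_mono) (auto intro: mult_left_mono)
    then have "l\<^sup>2 * ((exp (l * t) - 1 - l * t) * y\<^sup>2) \<le> l\<^sup>2 * ((exp (l * y) - 1 - l * y) * t\<^sup>2)"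
      by (simp add: power_mult_distrib mult_ac)
    then have "(exp (l * t) - 1 - l * t) * y\<^sup>2 \<le> (exp (l * y) - 1 - l * y) * t\<^sup>2"
      using \<open>0 < l\<^sup>2\<close> by (simp only: mult_le_cancel_left_pos)
    then show ?thesis using False by (simp add: jump_comp_def pos_le_divide_eq)
  qed
  then show ?thesis using True by simp
next
  case False
  have "l\<^sup>2 / 2 * t\<^sup>2 \<le> jump_comp y l * t\<^sup>2"
    by (rule mult_right_mono[OF jump_comp_ge[OF assms]]) simp
  then have "exp (l * t - jump_comp y l * t\<^sup>2) \<le> exp (l * t - (l * t)\<^sup>2 / 2)"
    by (simp add: power_mult_distrib)
  also have "\<dots> \<le> 1 + l * t"
    using False assms by (intro exp_minus_half_square_le) auto
  finally show ?thesis using False by simp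
qed

text \<open>Large jumps cannot make the compensated exponent large, since
  \<open>s - s\<^sup>2 / 2 \<le> 1\<close>. This makes the exponential process bounded, hence integrable, although the
  jumps are merely square integrable.\<close>
lemma exp_jump_bounded:
  assumes "0 \<le> y" "0 \<le> l"
  shows "l * t - jump_comp y l * (t\<^sup>2 * indicator {y<..} t) \<le> l * y + 1"
proof (cases "t \<le> y")
  case True
  have "l * t \<le> l * y" using True assms by (intro mult_left_mono)
  then show ?thesis using True by simp
next
  case False
  have "l\<^sup>2 / 2 * t\<^sup>2 \<le> jump_comp y l * t\<^sup>2"
    by (rule mult_right_mono[OF jump_comp_ge[OF assms]]) simp
  moreover have "0 \<le> (l * t - 1)\<^sup>2 / 2" by simp
  ultimately have "l * t - jump_comp y l * t\<^sup>2 \<le> 1"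
    by (simp add: power_mult_distrib power2_diff)
  then have "l * t - jump_comp y l * t\<^sup>2 \<le> l * y + 1"
    using mult_nonneg_nonneg[OF assms(2,1)] by linarith
  then show ?thesis using False by simp
qed

text \<open>The rate is the Legendre transform of Bennett's function; the maximiser is
  \<open>l = ln (1 + x y) / y\<close>, or \<open>l = x\<close> when \<open>y = 0\<close>.\<close>
lemma rate_f_attained:
  assumes "0 \<le> x" "0 \<le> y"
  obtains l where "0 \<le> l" "l * x - jump_comp y l = rate_f x y"
proof (cases "y = 0")
  case True
  then have "x * x - jump_comp y x = rate_f x y"
    by (simp add: jump_comp_def rate_f_def power2_eq_square)
  then show ?thesis using that assms by blast
next
  case False
  define l where "l = ln (x * y + 1) / y"
  have "0 \<le> x * y" using assms by simp
  then have "exp (l * y) = x * y + 1" using False by (simp add: l_def)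
  then have "l * x - jump_comp y l = rate_f x y"
    using False by (simp add: jump_comp_def rate_f_def l_def field_simps power2_eq_square)
  moreover have "0 \<le> l" using assms by (simp add: l_def)
  ultimately show ?thesis using that by blast
qed

text \<open>Both sides vanish to first order at \<open>0\<close>, and their second derivatives are
  \<open>27 / (3 + u)\<^sup>3\<close> and \<open>1 / (1 + u)\<close>. These compare because \<open>(3 + u)\<^sup>3 \<ge> 27 (1 + u)\<close>.\<close>
lemma bennett_ge_bernstein:
  fixes u :: real
  assumes "0 \<le> u"
  shows "u\<^sup>2 / (2 * (1 + u / 3)) \<le> (1 + u) * ln (1 + u) - u"
proof -
  \<comment> \<open>\<open>?f\<close> is the difference of the two sides, with the fraction on the left split by polynomial
    division; \<open>?d\<close> is its derivative.\<close>
  let ?d = "\<lambda>t::real. ln (1 + t) - (3 / 2 - 27 / 2 * inverse ((3 + t)\<^sup>2))"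
  let ?f = "\<lambda>t::real. (1 + t) * ln (1 + t) - t - (3 / 2 * t - 9 / 2 + 27 / 2 * inverse (3 + t))"
  have d_nonneg: "0 \<le> ?d t" if "0 \<le> t" for t
  proof -
    have "?d 0 \<le> ?d t"
    proof (rule DERIV_nonneg_imp_nondecreasing[OF that])
      fix s :: real
      assume s: "0 \<le> s"
      have "(?d has_real_derivative 1 / (1 + s) - 27 / (3 + s) ^ 3) (at s)"
      proof -
        have "(?d has_real_derivative
            1 / (1 + s) - 27 / 2 * (inverse ((3 + s)\<^sup>2) * (2 * (3 + s)) * inverse ((3 + s)\<^sup>2))) (at s)"
          using s by (auto intro!: derivative_eq_intros)
        moreover have "27 / 2 * (inverse (a\<^sup>2) * (2 * a) * inverse (a\<^sup>2)) = 27 / a ^ 3" if "0 < a" for a :: real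
          using that by (simp add: field_simps eval_nat_numeral)
        ultimately show ?thesis using s by (simp only:)
      qed
      moreover have "27 * (1 + s) \<le> (3 + s) ^ 3"
        using s by (simp add: algebra_simps eval_nat_numeral)
      then have "0 \<le> 1 / (1 + s) - 27 / (3 + s) ^ 3"
        using s by (simp add: divide_simps)
      ultimately show "\<exists>z. (?d has_real_derivative z) (at s) \<and> 0 \<le> z" by blast
    qed
    then show ?thesis by simp
  qed
  have "?f 0 \<le> ?f u"
  proof (rule DERIV_nonneg_imp_nondecreasing[OF assms])
    fix t :: real
    assume t: "0 \<le> t"
    have "(?f has_real_derivative ?d t) (at t)"
      using t by (auto intro!: derivative_eq_intros simp: power2_eq_square)
    then show "\<exists>z. (?f has_real_derivative z) (at t) \<and> 0 \<le> z"
      using d_nonneg[OF t] by blast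
  qed
  moreover have "u\<^sup>2 / (2 * (1 + u / 3)) = 3 / 2 * u - 9 / 2 + 27 / 2 * inverse (3 + u)"
    using assms by (simp add: field_simps power2_eq_square)
  ultimately show ?thesis by simp
qed

lemma rate_f_ge_bernstein:
  assumes "0 \<le> x" "0 \<le> y"
  shows "x\<^sup>2 / (2 * (1 + x * y / 3)) \<le> rate_f x y"
proof (cases "y = 0")
  case False
  have "x\<^sup>2 / (2 * (1 + x * y / 3)) = (x * y)\<^sup>2 / (2 * (1 + x * y / 3)) / y\<^sup>2"
    using False by (simp add: power_mult_distrib)
  also have "(x * y)\<^sup>2 / (2 * (1 + x * y / 3)) \<le> (1 + x * y) * ln (1 + x * y) - x * y"
    using assms by (intro bennett_ge_bernstein) simp
  then have "(x * y)\<^sup>2 / (2 * (1 + x * y / 3)) / y\<^sup>2 \<le> \<dots> / y\<^sup>2"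
    by (rule divide_right_mono) simp
  also have "\<dots> = rate_f x y"
    using False by (simp add: rate_f_def algebra_simps)
  finally show ?thesis .
qed (simp add: rate_f_def)

section \<open>From an exponential moment to a probability\<close>

text \<open>This plays the role of Hoelder's inequality. With \<open>P = prob A\<close>, the conditional mean
  of \<open>exp T\<close> given \<open>A\<close> is at most \<open>1 / P\<close>, so convexity of \<open>z \<mapsto> z powr (1 - p)\<close> bounds that
  of \<open>exp (- (p - 1) T)\<close> below by \<open>P powr (p - 1)\<close>. Convexity enters through the tangent
  at \<open>1 / P\<close>, integrated over \<open>A\<close>.\<close>
lemma (in prob_space) prob_le_exp_moment_powr:
  fixes T R :: "'a \<Rightarrow> real"
  assumes [measurable]: "A \<in> events" "R \<in> borel_measurable M"
    and int: "integrable M (\<lambda>\<omega>. exp (T \<omega>))" and le1: "(\<integral>\<omega>. exp (T \<omega>) \<partial>M) \<le> 1"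
    and R_le: "AE \<omega> in M. \<omega> \<in> A \<longrightarrow> R \<omega> \<le> T \<omega>"
    and R_nonneg: "AE \<omega> in M. 0 \<le> R \<omega>"
    and p: "1 < p"
  shows "prob A \<le> (\<integral>\<omega>. exp (- (p - 1) * R \<omega>) * indicator A \<omega> \<partial>M) powr (1 / p)"
proof (cases "prob A = 0")
  case False
  define P r where "P = prob A" and "r = p - 1"
  have P: "0 < P" using False by (simp add: P_def zero_less_measure_iff)
  have r: "0 < r" using p by (simp add: r_def)
  let ?I = "\<integral>\<omega>. exp (- r * R \<omega>) * indicator A \<omega> \<partial>M"
  \<comment> \<open>In terms of \<open>z = exp t\<close>: \<open>z powr (- r)\<close> lies above its tangent at \<open>1 / P\<close>.\<close>
  have tangent: "P powr r * (1 + r - r * P * exp t) \<le> exp (- r * t)" for t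
  proof -
    have "1 + (t + ln P) \<le> P * exp t"
      using exp_ge_add_one_self[of "t + ln P"] P by (simp add: exp_add mult.commute)
    then have "r * (1 + (t + ln P)) \<le> r * (P * exp t)" using r by simp
    then have "1 + r - r * P * exp t \<le> 1 + (- r * (t + ln P))" by (simp add: algebra_simps)
    also have "\<dots> \<le> exp (- r * (t + ln P))" by (rule exp_ge_add_one_self)
    finally have "P powr r * (1 + r - r * P * exp t) \<le> P powr r * exp (- r * (t + ln P))"
      by (rule mult_left_mono) simp
    also have "\<dots> = exp (- r * t)"
      using P by (simp add: powr_def algebra_simps flip: exp_add)
    finally show ?thesis .
  qed
  have int_1: "integrable M (indicator A :: 'a \<Rightarrow> real)"
    by (rule integrable_const_bound[where B = 1]) (auto simp: indicator_def)
  have int_A: "integrable M (\<lambda>\<omega>. exp (T \<omega>) * indicator A \<omega>)"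
    by (rule integrable_real_mult_indicator) (use int in auto)
  have "P powr p = P powr r * P"
    using P by (simp add: r_def powr_diff)
  also have "\<dots> = P powr r * ((1 + r) * P - r * P * 1)" by (simp add: algebra_simps)
  also have "\<dots> \<le> P powr r * ((1 + r) * P - r * P * (\<integral>\<omega>. exp (T \<omega>) * indicator A \<omega> \<partial>M))"
  proof -
    have "(\<integral>\<omega>. exp (T \<omega>) * indicator A \<omega> \<partial>M) \<le> (\<integral>\<omega>. exp (T \<omega>) \<partial>M)"
      by (rule integral_mono[OF int_A int]) (simp add: indicator_def)
    with le1 have "(\<integral>\<omega>. exp (T \<omega>) * indicator A \<omega> \<partial>M) \<le> 1" by simp
    then have "r * P * (\<integral>\<omega>. exp (T \<omega>) * indicator A \<omega> \<partial>M) \<le> r * P * 1"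
      using r P by (intro mult_left_mono) auto
    then show ?thesis by (intro mult_left_mono) auto
  qed
  also have "(1 + r) * P - r * P * (\<integral>\<omega>. exp (T \<omega>) * indicator A \<omega> \<partial>M)
      = (\<integral>\<omega>. (1 + r) * indicator A \<omega> - r * P * (exp (T \<omega>) * indicator A \<omega>) \<partial>M)"
    by (subst Bochner_Integration.integral_diff) (use int_A int_1 in \<open>auto simp: P_def\<close>)
  also have "P powr r * \<dots> = (\<integral>\<omega>. P powr r * ((1 + r) * indicator A \<omega> - r * P * (exp (T \<omega>) * indicator A \<omega>)) \<partial>M)"
    by simp
  also have "\<dots> \<le> ?I"
  proof (rule integral_mono_AE)
    show "integrable M (\<lambda>\<omega>. P powr r * ((1 + r) * indicator A \<omega> - r * P * (exp (T \<omega>) * indicator A \<omega>)))"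
      using int_A int_1 by (intro integrable_mult_right Bochner_Integration.integrable_diff) auto
    show "integrable M (\<lambda>\<omega>. exp (- r * R \<omega>) * indicator A \<omega>)"
      by (rule integrable_const_bound[where B = 1])
         (use R_nonneg r in \<open>auto simp: indicator_def\<close>)
    show "AE \<omega> in M. P powr r * ((1 + r) * indicator A \<omega> - r * P * (exp (T \<omega>) * indicator A \<omega>))
        \<le> exp (- r * R \<omega>) * indicator A \<omega>"
      using R_le
    proof eventually_elim
      case (elim \<omega>)
      show ?case
      proof (cases "\<omega> \<in> A")
        case True
        with elim r have "exp (- r * T \<omega>) \<le> exp (- r * R \<omega>)" by simp
        from order_trans[OF tangent this] show ?thesis
          using True by (simp add: mult.assoc)
      qed simp
    qed
  qed
  finally have "(P powr p) powr (1 / p) \<le> ?I powr (1 / p)"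
    using p by (intro powr_mono2) auto
  then show ?thesis using p P by (simp add: powr_powr P_def r_def)
qed simp

section \<open>One step of the exponential supermartingale\<close>

lemma (in finite_measure) integrable_mult_bounded:
  fixes W h :: "'a \<Rightarrow> real"
  assumes [measurable]: "W \<in> borel_measurable M"
    and "AE \<omega> in M. 0 \<le> W \<omega> \<and> W \<omega> \<le> C" and h: "integrable M h"
  shows "integrable M (\<lambda>\<omega>. W \<omega> * h \<omega>)"
proof (rule Bochner_Integration.integrable_bound)
  show "integrable M (\<lambda>\<omega>. C * h \<omega>)" using h by simp
  have [measurable]: "h \<in> borel_measurable M" using h by simp
  show "(\<lambda>\<omega>. W \<omega> * h \<omega>) \<in> borel_measurable M" by measurable
  show "AE \<omega> in M. norm (W \<omega> * h \<omega>) \<le> norm (C * h \<omega>)"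
    using assms(2) by eventually_elim (auto simp: abs_mult intro!: mult_right_mono)
qed

lemma indicator_Collect_gt: "indicator {\<omega>'. X \<omega>' > y} \<omega> = indicator {y<..} (X \<omega>)"
  by (simp add: indicator_def)

lemma indicator_Collect_le: "indicator {\<omega>'. X \<omega>' \<le> y} \<omega> = indicator {..y} (X \<omega>)"
  by (simp add: indicator_def)

lemma (in finite_measure) integrable_square_truncation:
  fixes X :: "'a \<Rightarrow> real"
  assumes [measurable]: "X \<in> borel_measurable M" and sq: "integrable M (\<lambda>\<omega>. (X \<omega>)\<^sup>2)"
  shows "integrable M (\<lambda>\<omega>. (X \<omega>)\<^sup>2 * indicator {\<omega>'. X \<omega>' \<le> y} \<omega>)"
  unfolding indicator_Collect_le
  by (rule Bochner_Integration.integrable_bound[OF sq]) (auto simp: indicator_def)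

text \<open>One step of the supermartingale property, integrated against a past
  weight \<open>W\<close>. By \<open>exp_jump_le\<close> the exponential is at most \<open>1 + l X + c Q\<close>; conditionally on
  the past the linear term vanishes and \<open>Q\<close> becomes its conditional expectation \<open>V\<close>; finally
  \<open>1 + c V \<le> exp (c V)\<close> is cancelled by the factor \<open>exp (- c V)\<close>. Boundedness of \<open>W\<close> secures
  integrability of all products.\<close>
lemma (in finite_measure_subalgebra) compensated_exp_step:
  fixes W X :: "'a \<Rightarrow> real" and y l C :: real
  defines "Q \<equiv> \<lambda>\<omega>. (X \<omega>)\<^sup>2 * indicator {\<omega>'. X \<omega>' \<le> y} \<omega>"
  assumes WF[measurable]: "W \<in> borel_measurable F" and X[measurable]: "X \<in> borel_measurable M"
    and W: "AE \<omega> in M. 0 \<le> W \<omega> \<and> W \<omega> \<le> C"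
    and sq: "integrable M (\<lambda>\<omega>. (X \<omega>)\<^sup>2)"
    and mart: "AE \<omega> in M. real_cond_exp M F X \<omega> = 0"
    and y: "0 \<le> y" and l: "0 \<le> l"
  shows "(\<integral>\<omega>. W \<omega> * exp (l * X \<omega> - jump_comp y l *
            ((X \<omega>)\<^sup>2 * indicator {\<omega>'. X \<omega>' > y} \<omega> + real_cond_exp M F Q \<omega>)) \<partial>M)
         \<le> (\<integral>\<omega>. W \<omega> \<partial>M)"
proof -
  define c where "c = jump_comp y l"
  define V where "V = real_cond_exp M F Q"
  define W' where "W' = (\<lambda>\<omega>. W \<omega> * exp (- c * V \<omega>))"
  define D where "D = (\<lambda>\<omega>. exp (l * X \<omega> - c * ((X \<omega>)\<^sup>2 * indicator {y<..} (X \<omega>))))"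
  have c: "0 \<le> c" using order_trans[OF _ jump_comp_ge[OF y l], of 0] by (simp add: c_def)
  have [measurable]: "W \<in> borel_measurable M" by (rule measurable_from_subalg[OF subalg WF])
  have intX: "integrable M X" using square_integrable_imp_integrable[OF X] sq by simp
  have intQ: "integrable M Q"
    unfolding Q_def by (rule integrable_square_truncation[OF X sq])
  have [measurable]: "Q \<in> borel_measurable M" using intQ by simp
  have VF[measurable]: "V \<in> borel_measurable F" by (simp add: V_def)
  have [measurable]: "V \<in> borel_measurable M" by (rule measurable_from_subalg[OF subalg VF])
  have V: "AE \<omega> in M. 0 \<le> V \<omega>"
    unfolding V_def by (rule real_cond_exp_pos) (auto simp: Q_def)
  have W'F[measurable]: "W' \<in> borel_measurable F" unfolding W'_def by measurable
  have [measurable]: "W' \<in> borel_measurable M" by (rule measurable_from_subalg[OF subalg W'F])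
  have W': "AE \<omega> in M. 0 \<le> W' \<omega> \<and> W' \<omega> \<le> C"
    using W V
  proof eventually_elim
    case (elim \<omega>)
    then have "W \<omega> * exp (- c * V \<omega>) \<le> W \<omega> * 1"
      using c by (intro mult_left_mono) auto
    with elim show ?case by (auto simp: W'_def)
  qed
  note int = integrable_mult_bounded[OF _ W']
  have intD: "integrable M D"
    unfolding D_def by (rule integrable_const_bound[where B = "exp (l * y + 1)"])
      (auto simp: c_def exp_jump_bounded[OF y l])
  have int1: "integrable M W'" using int[of "\<lambda>_. 1"] by simp
  have "(\<integral>\<omega>. W \<omega> * exp (l * X \<omega> - c * ((X \<omega>)\<^sup>2 * indicator {\<omega>'. X \<omega>' > y} \<omega> + V \<omega>)) \<partial>M)
      = (\<integral>\<omega>. W' \<omega> * D \<omega> \<partial>M)"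
    by (simp add: W'_def D_def indicator_Collect_gt algebra_simps flip: exp_add)
  also have "\<dots> \<le> (\<integral>\<omega>. W' \<omega> + l * (W' \<omega> * X \<omega>) + c * (W' \<omega> * Q \<omega>) \<partial>M)"
  proof (rule integral_mono_AE)
    show "AE \<omega> in M. W' \<omega> * D \<omega> \<le> W' \<omega> + l * (W' \<omega> * X \<omega>) + c * (W' \<omega> * Q \<omega>)"
      using W'
    proof eventually_elim
      case (elim \<omega>)
      have "W' \<omega> * D \<omega> \<le> W' \<omega> * (1 + l * X \<omega> + c * Q \<omega>)"
        using elim exp_jump_le[OF y l, of "X \<omega>"]
        by (intro mult_left_mono) (auto simp: D_def Q_def c_def indicator_Collect_le)
      then show ?case by (simp add: algebra_simps)
    qed
  qed (use int int1 intX intQ intD in auto)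
  also have "\<dots> = (\<integral>\<omega>. W' \<omega> \<partial>M) + l * (\<integral>\<omega>. W' \<omega> * X \<omega> \<partial>M) + c * (\<integral>\<omega>. W' \<omega> * Q \<omega> \<partial>M)"
    using int int1 intX intQ by simp
  also have "(\<integral>\<omega>. W' \<omega> * X \<omega> \<partial>M) = (\<integral>\<omega>. W' \<omega> * real_cond_exp M F X \<omega> \<partial>M)"
    by (rule real_cond_exp_intg(2)[symmetric]) (use int intX in auto)
  also have "\<dots> = (\<integral>\<omega>. 0 \<partial>M)"
    by (rule integral_cong_AE) (use mart in auto)
  also have "(\<integral>\<omega>. W' \<omega> * Q \<omega> \<partial>M) = (\<integral>\<omega>. W' \<omega> * V \<omega> \<partial>M)"
    unfolding V_def by (rule real_cond_exp_intg(2)[symmetric]) (use int intQ in auto)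
  also have "(\<integral>\<omega>. W' \<omega> \<partial>M) + l * (\<integral>\<omega>. 0 \<partial>M) + c * (\<integral>\<omega>. W' \<omega> * V \<omega> \<partial>M)
      = (\<integral>\<omega>. W' \<omega> * (1 + c * V \<omega>) \<partial>M)"
    using int[of V] int1 real_cond_exp_int(1)[OF intQ] by (simp add: V_def algebra_simps)
  also have "\<dots> \<le> (\<integral>\<omega>. W \<omega> \<partial>M)"
  proof (rule integral_mono_AE)
    show "integrable M (\<lambda>\<omega>. W' \<omega> * (1 + c * V \<omega>))"
      using int real_cond_exp_int(1)[OF intQ] by (simp add: V_def)
    show "integrable M W"
      using integrable_mult_bounded[OF _ W, of "\<lambda>_. 1"] by simp
    show "AE \<omega> in M. W' \<omega> * (1 + c * V \<omega>) \<le> W \<omega>"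
      using W'
    proof eventually_elim
      case (elim \<omega>)
      have "W' \<omega> * (1 + c * V \<omega>) \<le> W' \<omega> * exp (c * V \<omega>)"
        using elim by (intro mult_left_mono) auto
      also have "\<dots> = W \<omega>" by (simp add: W'_def flip: exp_add)
      finally show ?case .
    qed
  qed
  finally show ?thesis by (simp add: c_def V_def)
qed

text \<open>Where the conditional expectation of a nonnegative variable vanishes, the
  variable itself vanishes almost surely: that set belongs to the sub-\<open>\<sigma>\<close>-algebra, so both have
  the same integral over it.\<close>
lemma (in finite_measure_subalgebra) AE_zero_if_cond_square_zero:
  fixes X :: "'a \<Rightarrow> real"
  assumes X[measurable]: "X \<in> borel_measurable M" and sq: "integrable M (\<lambda>\<omega>. (X \<omega>)\<^sup>2)"
  shows "AE \<omega> in M. real_cond_exp M F (\<lambda>\<omega>. (X \<omega>)\<^sup>2 * indicator {\<omega>'. X \<omega>' \<le> y} \<omega>) \<omega> = 0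
           \<longrightarrow> X \<omega> \<le> y \<longrightarrow> X \<omega> = 0"
proof -
  define Q where "Q = (\<lambda>\<omega>. (X \<omega>)\<^sup>2 * indicator {\<omega>'. X \<omega>' \<le> y} \<omega>)"
  define V where "V = real_cond_exp M F Q"
  define J where "J = (\<lambda>\<omega>. indicator {0} (V \<omega>) :: real)"
  have intQ: "integrable M Q"
    unfolding Q_def by (rule integrable_square_truncation[OF X sq])
  have [measurable]: "Q \<in> borel_measurable M" using intQ by simp
  have VF[measurable]: "V \<in> borel_measurable F" by (simp add: V_def)
  have JF[measurable]: "J \<in> borel_measurable F" unfolding J_def by measurable
  have [measurable]: "J \<in> borel_measurable M" by (rule measurable_from_subalg[OF subalg JF])
  have int: "integrable M (\<lambda>\<omega>. J \<omega> * Q \<omega>)"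
    by (rule integrable_mult_bounded[OF _ _ intQ, where C = 1]) (measurable, simp add: J_def)
  have "(\<integral>\<omega>. J \<omega> * Q \<omega> \<partial>M) = (\<integral>\<omega>. J \<omega> * V \<omega> \<partial>M)"
    unfolding V_def by (rule real_cond_exp_intg(2)[symmetric]) (use int in auto)
  also have "\<dots> = 0"
    by (rule integral_eq_zero_AE) (simp add: J_def indicator_def)
  finally have "AE \<omega> in M. J \<omega> * Q \<omega> = 0"
    using integral_nonneg_eq_0_iff_AE[OF int] by (auto simp: J_def Q_def)
  then show ?thesis
    by eventually_elim (auto simp: J_def V_def Q_def indicator_def split: if_splits)
qed

section \<open>Square integrable martingale differences\<close>

lemma sq_int_mart_diffD:
  assumes "sq_int_mart_diff M F n \<xi>"
  shows "prob_space M"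
    and "i \<le> n \<Longrightarrow> finite_measure_subalgebra M (F i)"
    and "i \<le> j \<Longrightarrow> j \<le> n \<Longrightarrow> f \<in> borel_measurable (F i) \<Longrightarrow> f \<in> borel_measurable (F j)"
    and "i \<le> n \<Longrightarrow> f \<in> borel_measurable (F i) \<Longrightarrow> f \<in> borel_measurable M"
    and "i \<le> n \<Longrightarrow> \<xi> i \<in> borel_measurable (F i)"
    and "1 \<le> i \<Longrightarrow> i \<le> n \<Longrightarrow> integrable M (\<lambda>\<omega>. (\<xi> i \<omega>)\<^sup>2)"
    and "1 \<le> i \<Longrightarrow> i \<le> n \<Longrightarrow> AE \<omega> in M. real_cond_exp M (F (i - 1)) (\<xi> i) \<omega> = 0"
proof -
  note def = assms[unfolded sq_int_mart_diff_def]
  from def have sub: "\<And>i. i \<le> n \<Longrightarrow> subalgebra M (F i)"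
    and mono: "\<And>i j. i \<le> j \<Longrightarrow> j \<le> n \<Longrightarrow> subalgebra (F j) (F i)" by blast+
  show "prob_space M" using def by blast
  then show "finite_measure_subalgebra M (F i)" if "i \<le> n"
    using sub[OF that]
    by (simp add: prob_space_def finite_measure_subalgebra_def finite_measure_subalgebra_axioms_def)
  show "f \<in> borel_measurable (F j)" if "i \<le> j" "j \<le> n" "f \<in> borel_measurable (F i)"
    by (rule measurable_from_subalg[OF mono[OF that(1,2)] that(3)])
  show "f \<in> borel_measurable M" if "i \<le> n" "f \<in> borel_measurable (F i)"
    by (rule measurable_from_subalg[OF sub[OF that(1)] that(2)])
  show "\<xi> i \<in> borel_measurable (F i)" if "i \<le> n" using def that by blast
  show "integrable M (\<lambda>\<omega>. (\<xi> i \<omega>)\<^sup>2)" "AE \<omega> in M. real_cond_exp M (F (i - 1)) (\<xi> i) \<omega> = 0"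
    if "1 \<le> i" "i \<le> n"
    using def that by (meson atLeastAtMost_iff)+
qed

lemma mart_sum_Suc: "mart_sum \<xi> (Suc k) \<omega> = mart_sum \<xi> k \<omega> + \<xi> (Suc k) \<omega>"
  by (simp add: mart_sum_def)

lemma var_B_Suc:
  "var_B M F \<xi> (Suc k) y \<omega> = var_B M F \<xi> k y \<omega>
     + ((\<xi> (Suc k) \<omega>)\<^sup>2 * indicator {\<omega>'. \<xi> (Suc k) \<omega>' > y} \<omega>
        + real_cond_exp M (F k) (\<lambda>\<omega>. (\<xi> (Suc k) \<omega>)\<^sup>2 * indicator {\<omega>'. \<xi> (Suc k) \<omega>' \<le> y} \<omega>) \<omega>)"
  by (simp add: var_B_def sq_bracket_def angle_bracket_def)

lemma mart_sum_var_B_measurable: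
  assumes "sq_int_mart_diff M F n \<xi>" and "k \<le> n"
  shows "mart_sum \<xi> k \<in> borel_measurable (F k)" "var_B M F \<xi> k y \<in> borel_measurable (F k)"
proof -
  note D = sq_int_mart_diffD[OF assms(1)]
  have \<xi>: "\<xi> i \<in> borel_measurable (F k)" if "i \<le> k" for i
    using that D(3)[OF that assms(2) D(5)] assms(2) by simp
  then show "mart_sum \<xi> k \<in> borel_measurable (F k)"
    unfolding mart_sum_def by (intro borel_measurable_sum) auto
  have "real_cond_exp M (F (i - 1)) f \<in> borel_measurable (F k)" if "i \<le> k" for i f
    using that assms(2) by (intro D(3)[of "i - 1" k]) auto
  moreover have "(\<lambda>\<omega>. (\<xi> i \<omega>)\<^sup>2 * indicator {\<omega>'. \<xi> i \<omega>' > y} \<omega>) \<in> borel_measurable (F k)" if "i \<le> k" for i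
    using \<xi>[OF that] unfolding indicator_Collect_gt by measurable
  ultimately show "var_B M F \<xi> k y \<in> borel_measurable (F k)"
    unfolding var_B_def sq_bracket_def angle_bracket_def
    by (intro borel_measurable_add borel_measurable_sum) auto
qed

text \<open>The exponential supermartingale starts at \<open>1\<close>. The induction carries a deterministic
  upper bound along with the expectation, because each step requires a bounded weight.\<close>
lemma exp_mart_le_one:
  assumes sq: "sq_int_mart_diff M F n \<xi>" and y: "0 \<le> y" and l: "0 \<le> l"
  shows "integrable M (\<lambda>\<omega>. exp (l * mart_sum \<xi> n \<omega> - jump_comp y l * var_B M F \<xi> n y \<omega>))"
    and "(\<integral>\<omega>. exp (l * mart_sum \<xi> n \<omega> - jump_comp y l * var_B M F \<xi> n y \<omega>) \<partial>M) \<le> 1"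
proof -
  note D = sq_int_mart_diffD[OF sq]
  interpret prob_space M by (rule D(1))
  define c where "c = jump_comp y l"
  have c: "0 \<le> c" using order_trans[OF _ jump_comp_ge[OF y l], of 0] by (simp add: c_def)
  define U where "U = (\<lambda>k \<omega>. exp (l * mart_sum \<xi> k \<omega> - c * var_B M F \<xi> k y \<omega>))"
  have UF: "U k \<in> borel_measurable (F k)" if "k \<le> n" for k
    using mart_sum_var_B_measurable(1)[OF sq that] mart_sum_var_B_measurable(2)[OF sq that, of y]
    unfolding U_def by measurable
  have "(AE \<omega> in M. U k \<omega> \<le> exp (l * y + 1) ^ k) \<and> (\<integral>\<omega>. U k \<omega> \<partial>M) \<le> 1" if "k \<le> n" for k
    using that
  proof (induction k)
    case 0
    have "{1..0::nat} = {}" by simp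
    then have "U 0 = (\<lambda>_. 1)"
      by (simp only: U_def mart_sum_def var_B_def sq_bracket_def angle_bracket_def sum.empty) simp
    then show ?case by (simp add: prob_space)
  next
    case (Suc k)
    then have k: "k \<le> n" and Sk: "1 \<le> Suc k" "Suc k \<le> n" by auto
    interpret F: finite_measure_subalgebra M "F k" by (rule D(2)[OF k])
    let ?X = "\<xi> (Suc k)"
    define V where "V = real_cond_exp M (F k) (\<lambda>\<omega>. (?X \<omega>)\<^sup>2 * indicator {\<omega>'. ?X \<omega>' \<le> y} \<omega>)"
    have X[measurable]: "?X \<in> borel_measurable M" by (rule D(4)[OF Sk(2) D(5)[OF Sk(2)]])
    have V: "AE \<omega> in M. 0 \<le> V \<omega>"
      unfolding V_def by (rule F.real_cond_exp_pos) (auto simp: indicator_Collect_le)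
    have step: "U (Suc k) \<omega> = U k \<omega> * exp (l * ?X \<omega> - c * ((?X \<omega>)\<^sup>2 * indicator {\<omega>'. ?X \<omega>' > y} \<omega> + V \<omega>))" for \<omega>
      by (simp add: U_def V_def mart_sum_Suc var_B_Suc algebra_simps flip: exp_add)
    have IH: "AE \<omega> in M. U k \<omega> \<le> exp (l * y + 1) ^ k" "(\<integral>\<omega>. U k \<omega> \<partial>M) \<le> 1"
      using Suc.IH[OF k] by auto
    have "AE \<omega> in M. U (Suc k) \<omega> \<le> exp (l * y + 1) ^ Suc k"
      using IH(1) V
    proof eventually_elim
      case (elim \<omega>)
      have "exp (l * ?X \<omega> - c * ((?X \<omega>)\<^sup>2 * indicator {\<omega>'. ?X \<omega>' > y} \<omega> + V \<omega>))
          \<le> exp (l * ?X \<omega> - c * ((?X \<omega>)\<^sup>2 * indicator {y<..} (?X \<omega>)))"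
        using elim c by (simp add: indicator_Collect_gt distrib_left)
      also have "\<dots> \<le> exp (l * y + 1)" using exp_jump_bounded[OF y l] by (simp add: c_def)
      finally have "U (Suc k) \<omega> \<le> exp (l * y + 1) ^ k * exp (l * y + 1)"
        unfolding step using elim by (intro mult_mono) auto
      then show ?case by (simp add: mult.commute)
    qed
    moreover have "(\<integral>\<omega>. U (Suc k) \<omega> \<partial>M) \<le> (\<integral>\<omega>. U k \<omega> \<partial>M)"
      unfolding step c_def V_def
      by (rule F.compensated_exp_step[where C = "exp (l * y + 1) ^ k"])
         (use IH(1) D(6,7)[OF Sk] UF[OF k] y l in \<open>auto simp: U_def\<close>)
    ultimately show ?case using IH(2) by simp
  qed
  note this[OF order_refl]
  moreover have "U n \<in> borel_measurable M" by (rule D(4)[OF _ UF]) auto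
  ultimately have "integrable M (U n) \<and> (\<integral>\<omega>. U n \<omega> \<partial>M) \<le> 1"
    by (auto intro!: integrable_const_bound[where B = "exp (l * y + 1) ^ n"] simp: U_def)
  then show "integrable M (\<lambda>\<omega>. exp (l * mart_sum \<xi> n \<omega> - jump_comp y l * var_B M F \<xi> n y \<omega>))"
    and "(\<integral>\<omega>. exp (l * mart_sum \<xi> n \<omega> - jump_comp y l * var_B M F \<xi> n y \<omega>) \<partial>M) \<le> 1"
    by (simp_all add: U_def c_def)
qed

text \<open>Every summand of \<open>B\<^sub>n(y)\<close> is almost surely nonnegative, so \<open>B\<^sub>n(y) = 0\<close> makes
  each of them vanish, which leaves no nonzero jump on either side of \<open>y\<close>. For \<open>x = 0\<close>
  this is what reconciles the convention \<open>0 / 0 = 0\<close> with the event \<open>S\<^sub>n \<ge> x B\<^sub>n(y)\<close>.\<close>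
lemma AE_var_B_nonneg_and_null:
  assumes sq: "sq_int_mart_diff M F n \<xi>"
  shows "AE \<omega> in M. 0 \<le> var_B M F \<xi> n y \<omega> \<and> (var_B M F \<xi> n y \<omega> = 0 \<longrightarrow> mart_sum \<xi> n \<omega> = 0)"
proof -
  note D = sq_int_mart_diffD[OF sq]
  let ?v = "\<lambda>i. real_cond_exp M (F (i - 1)) (\<lambda>\<omega>. (\<xi> i \<omega>)\<^sup>2 * indicator {\<omega>'. \<xi> i \<omega>' \<le> y} \<omega>)"
  let ?b = "\<lambda>i \<omega>. (\<xi> i \<omega>)\<^sup>2 * indicator {\<omega>'. \<xi> i \<omega>' > y} \<omega> + ?v i \<omega>"
  have B: "var_B M F \<xi> n y \<omega> = (\<Sum>i=1..n. ?b i \<omega>)" for \<omega>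
    by (simp add: var_B_def sq_bracket_def angle_bracket_def sum.distrib)
  have "AE \<omega> in M. 0 \<le> ?v i \<omega> \<and> (?v i \<omega> = 0 \<longrightarrow> \<xi> i \<omega> \<le> y \<longrightarrow> \<xi> i \<omega> = 0)" if "i \<in> {1..n}" for i
  proof -
    from that have i: "1 \<le> i" "i \<le> n" by auto
    interpret F: finite_measure_subalgebra M "F (i - 1)" by (rule D(2)) (use i in simp)
    have X[measurable]: "\<xi> i \<in> borel_measurable M" by (rule D(4)[OF i(2) D(5)[OF i(2)]])
    have "AE \<omega> in M. 0 \<le> ?v i \<omega>"
      by (rule F.real_cond_exp_pos) (auto simp: indicator_Collect_le)
    with F.AE_zero_if_cond_square_zero[OF X D(6)[OF i]] show ?thesis by eventually_elim auto
  qed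
  then have "AE \<omega> in M. \<forall>i\<in>{1..n}. 0 \<le> ?v i \<omega> \<and> (?v i \<omega> = 0 \<longrightarrow> \<xi> i \<omega> \<le> y \<longrightarrow> \<xi> i \<omega> = 0)"
    by (intro AE_finite_allI) auto
  then show ?thesis
  proof eventually_elim
    case (elim \<omega>)
    then have nonneg: "\<And>i. i \<in> {1..n} \<Longrightarrow> 0 \<le> ?b i \<omega>" by simp
    then have "0 \<le> var_B M F \<xi> n y \<omega>" unfolding B by (rule sum_nonneg)
    moreover have "mart_sum \<xi> n \<omega> = 0" if "var_B M F \<xi> n y \<omega> = 0"
    proof -
      have "\<xi> i \<omega> = 0" if i: "i \<in> {1..n}" for i
      proof -
        note zero = \<open>var_B M F \<xi> n y \<omega> = 0\<close>
        have "?b i \<omega> = 0"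
          by (rule sum_nonneg_0[of "{1..n}"]) (use nonneg i zero[unfolded B] in auto)
        then have "(\<xi> i \<omega>)\<^sup>2 * indicator {\<omega>'. \<xi> i \<omega>' > y} \<omega> = 0 \<and> ?v i \<omega> = 0"
          by (subst (asm) add_nonneg_eq_0_iff) (use elim i in auto)
        then show ?thesis using bspec[OF elim i] by (cases "\<xi> i \<omega> \<le> y") auto
      qed
      then show ?thesis by (simp add: mart_sum_def)
    qed
    ultimately show ?case by blast
  qed
qed

section \<open>The deviation inequalities\<close>

theorem theorem2p1:
  fixes M :: "'a measure" and F :: "nat \<Rightarrow> 'a measure"
    and \<xi> :: "nat \<Rightarrow> 'a \<Rightarrow> real" and n :: nat
  assumes "n \<ge> 1"
    and "sq_int_mart_diff M F n \<xi>"
  shows "(\<forall>x y :: real. x \<ge> 0 \<and> y \<ge> 0 \<longrightarrow>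
            \<P>(\<omega> in M. mart_sum \<xi> n \<omega> / var_B M F \<xi> n y \<omega> \<ge> x)
              \<le> (INF p\<in>{1<..}.
                   (\<integral>\<omega>. exp (- (p - 1) * rate_f x y * var_B M F \<xi> n y \<omega>)
                        * indicator {\<omega>\<in>space M. mart_sum \<xi> n \<omega> \<ge> x * var_B M F \<xi> n y \<omega>} \<omega> \<partial>M) powr (1 / p))
          \<and> (INF p\<in>{1<..}.
                   (\<integral>\<omega>. exp (- (p - 1) * rate_f x y * var_B M F \<xi> n y \<omega>)
                        * indicator {\<omega>\<in>space M. mart_sum \<xi> n \<omega> \<ge> x * var_B M F \<xi> n y \<omega>} \<omega> \<partial>M) powr (1 / p))
              \<le> (INF p\<in>{1<..}.
                   (\<integral>\<omega>. exp (- (p - 1) * (x\<^sup>2 / (2 * (1 + x * y / 3))) * var_B M F \<xi> n y \<omega>)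
                        * indicator {\<omega>\<in>space M. mart_sum \<xi> n \<omega> \<ge> x * var_B M F \<xi> n y \<omega>} \<omega> \<partial>M) powr (1 / p))
          \<and> \<P>(\<omega> in M. mart_sum \<xi> n \<omega> / var_B M F \<xi> n y \<omega> \<ge> x)
              \<le> (INF p\<in>{1<..}.
                   (\<integral>\<omega>. exp (- (p - 1) * (x\<^sup>2 / (2 * (1 + x * y / 3))) * var_B M F \<xi> n y \<omega>) \<partial>M)
                     powr (1 / p)))
       \<and> (\<forall>x y z :: real. x > 0 \<and> y > 0 \<and> z > 0 \<longrightarrow>
            \<P>(\<omega> in M. mart_sum \<xi> n \<omega> / var_B M F \<xi> n y \<omega> \<ge> x \<and> var_B M F \<xi> n y \<omega> \<ge> z)
              \<le> exp (- (x\<^sup>2 * z / (2 * (1 + x * y / 3)))))"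
proof -
  note D = sq_int_mart_diffD[OF assms(2)]
  interpret prob_space M by (rule D(1))
  let ?S = "mart_sum \<xi> n" and ?B = "\<lambda>y. var_B M F \<xi> n y"
  have [measurable]: "?S \<in> borel_measurable M" "?B y \<in> borel_measurable M" for y
    using mart_sum_var_B_measurable[OF assms(2) order_refl] by (auto intro: D(4)[of n])
  have chain:
    "\<P>(\<omega> in M. ?S \<omega> / ?B y \<omega> \<ge> x) \<le> (INF p\<in>{1<..}. (\<integral>\<omega>. exp (- (p - 1) * rate_f x y * ?B y \<omega>)
        * indicator {\<omega>\<in>space M. ?S \<omega> \<ge> x * ?B y \<omega>} \<omega> \<partial>M) powr (1 / p))"
      (is "?P \<le> (INF p\<in>_. ?I p powr _)")
    "(INF p\<in>{1<..}. (\<integral>\<omega>. exp (- (p - 1) * rate_f x y * ?B y \<omega>)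
        * indicator {\<omega>\<in>space M. ?S \<omega> \<ge> x * ?B y \<omega>} \<omega> \<partial>M) powr (1 / p))
      \<le> (INF p\<in>{1<..}. (\<integral>\<omega>. exp (- (p - 1) * (x\<^sup>2 / (2 * (1 + x * y / 3))) * ?B y \<omega>)
        * indicator {\<omega>\<in>space M. ?S \<omega> \<ge> x * ?B y \<omega>} \<omega> \<partial>M) powr (1 / p))"
      (is "_ \<le> (INF p\<in>_. ?J p powr _)")
    "(INF p\<in>{1<..}. (\<integral>\<omega>. exp (- (p - 1) * (x\<^sup>2 / (2 * (1 + x * y / 3))) * ?B y \<omega>)
        * indicator {\<omega>\<in>space M. ?S \<omega> \<ge> x * ?B y \<omega>} \<omega> \<partial>M) powr (1 / p))
      \<le> (INF p\<in>{1<..}. (\<integral>\<omega>. exp (- (p - 1) * (x\<^sup>2 / (2 * (1 + x * y / 3))) * ?B y \<omega>) \<partial>M) powr (1 / p))"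
      (is "_ \<le> (INF p\<in>_. ?K p powr _)")
    if x: "0 \<le> x" and y: "0 \<le> y" for x y
  proof -
    define A where "A = {\<omega>\<in>space M. ?S \<omega> \<ge> x * ?B y \<omega>}"
    have A[measurable]: "A \<in> events" unfolding A_def by measurable
    define b where "b = x\<^sup>2 / (2 * (1 + x * y / 3))"
    have b: "0 \<le> b" "b \<le> rate_f x y"
      using rate_f_ge_bernstein[OF x y] x y by (auto simp: b_def)
    note B = AE_var_B_nonneg_and_null[OF assms(2), of y]
    obtain l where l: "0 \<le> l" "l * x - jump_comp y l = rate_f x y"
      by (rule rate_f_attained[OF x y])
    have bdd: "bdd_below ((\<lambda>p. g p powr (1 / p)) ` {1<..})" for g :: "real \<Rightarrow> real"
      by (rule bdd_belowI[of _ 0]) auto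
    have int: "integrable M (\<lambda>\<omega>. exp (- (p - 1) * a * ?B y \<omega>))" if "0 \<le> a" "1 < p" for a p
    proof (rule integrable_const_bound[where B = 1])
      show "AE \<omega> in M. norm (exp (- (p - 1) * a * ?B y \<omega>)) \<le> 1"
        using B
      proof eventually_elim
        case (elim \<omega>)
        then have "0 \<le> (p - 1) * a * ?B y \<omega>" using that by simp
        then show ?case unfolding mult_minus_left by simp
      qed
    qed measurable
    have int_A: "integrable M (\<lambda>\<omega>. exp (- (p - 1) * a * ?B y \<omega>) * indicator A \<omega>)"
      if "0 \<le> a" "1 < p" for a p
      by (rule integrable_real_mult_indicator[OF A int[OF that]])
    have "?P \<le> prob A"
    proof (rule finite_measure_mono_AE)
      show "AE \<omega> in M. \<omega> \<in> {\<omega>\<in>space M. ?S \<omega> / ?B y \<omega> \<ge> x} \<longrightarrow> \<omega> \<in> A"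
        using B
      proof eventually_elim
        case (elim \<omega>)
        then show ?case by (cases "?B y \<omega> = 0") (auto simp: A_def pos_le_divide_eq)
      qed
    qed measurable
    moreover have "prob A \<le> ?I p powr (1 / p)" if "1 < p" for p
    proof -
      \<comment> \<open>On \<open>A\<close> the optimal exponent \<open>l S\<^sub>n - c B\<^sub>n(y)\<close> is at least \<open>(l x - c) B\<^sub>n(y)\<close>,
        where \<open>c = jump_comp y l\<close>.\<close>
      have "rate_f x y * ?B y \<omega> \<le> l * ?S \<omega> - jump_comp y l * ?B y \<omega>" if "\<omega> \<in> A" for \<omega>
      proof -
        have "l * (x * ?B y \<omega>) \<le> l * ?S \<omega>"
          using that l(1) by (intro mult_left_mono) (auto simp: A_def)
        then show ?thesis by (simp add: algebra_simps flip: l(2))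
      qed
      moreover have "AE \<omega> in M. 0 \<le> rate_f x y * ?B y \<omega>"
        using B by eventually_elim (use b in auto)
      ultimately show ?thesis
        using prob_le_exp_moment_powr[OF A _ exp_mart_le_one[OF assms(2) y l(1)] _ _ that,
            where R = "\<lambda>\<omega>. rate_f x y * ?B y \<omega>"]
        by (simp add: A_def mult.assoc)
    qed
    ultimately show "?P \<le> (INF p\<in>{1<..}. ?I p powr (1 / p))"
      by (intro cINF_greatest) (auto intro: order_trans)
    show "(INF p\<in>{1<..}. ?I p powr (1 / p)) \<le> (INF p\<in>{1<..}. ?J p powr (1 / p))"
    proof (rule cINF_mono)
      fix p :: real assume p: "p \<in> {1<..}"
      have "?I p \<le> ?J p"
        unfolding A_def[symmetric] b_def[symmetric]
      proof (rule integral_mono_AE)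
        show "AE \<omega> in M. exp (- (p - 1) * rate_f x y * ?B y \<omega>) * indicator A \<omega>
            \<le> exp (- (p - 1) * b * ?B y \<omega>) * indicator A \<omega>"
          using B
        proof eventually_elim
          case (elim \<omega>)
          then have "(p - 1) * b * ?B y \<omega> \<le> (p - 1) * rate_f x y * ?B y \<omega>"
            using p b by (intro mult_right_mono mult_left_mono) auto
          then show ?case
            unfolding mult_minus_left by (intro mult_right_mono) auto
        qed
      qed (rule int_A; use p b in auto)+
      then have "?I p powr (1 / p) \<le> ?J p powr (1 / p)"
        using p by (intro powr_mono2) (auto intro!: integral_nonneg_AE)
      then show "\<exists>q\<in>{1<..}. ?I q powr (1 / q) \<le> ?J p powr (1 / p)" using p by blast
    qed (use bdd in auto)
    show "(INF p\<in>{1<..}. ?J p powr (1 / p)) \<le> (INF p\<in>{1<..}. ?K p powr (1 / p))"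
    proof (rule cINF_mono)
      fix p :: real assume p: "p \<in> {1<..}"
      have "?J p \<le> ?K p"
        unfolding A_def[symmetric] b_def[symmetric]
        by (rule integral_mono[OF int_A int]) (use p b in \<open>auto simp: indicator_def\<close>)
      then have "?J p powr (1 / p) \<le> ?K p powr (1 / p)"
        using p by (intro powr_mono2) (auto intro!: integral_nonneg_AE)
      then show "\<exists>q\<in>{1<..}. ?J q powr (1 / q) \<le> ?K p powr (1 / p)" using p by blast
    qed (use bdd in auto)
  qed
  have tail: "\<P>(\<omega> in M. ?S \<omega> / ?B y \<omega> \<ge> x \<and> ?B y \<omega> \<ge> z) \<le> exp (- (x\<^sup>2 * z / (2 * (1 + x * y / 3))))"
    if x: "0 < x" and y: "0 < y" and z: "0 < z" for x y z
  proof -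
    define A where "A = {\<omega>\<in>space M. ?S \<omega> / ?B y \<omega> \<ge> x \<and> ?B y \<omega> \<ge> z}"
    have A[measurable]: "A \<in> events" unfolding A_def by measurable
    define b where "b = x\<^sup>2 / (2 * (1 + x * y / 3))"
    have b: "0 \<le> b" "b \<le> rate_f x y"
      using rate_f_ge_bernstein[of x y] x y by (auto simp: b_def)
    obtain l where l: "0 \<le> l" "l * x - jump_comp y l = rate_f x y"
      using rate_f_attained[of x y] x y by auto
    let ?T = "\<lambda>\<omega>. l * ?S \<omega> - jump_comp y l * ?B y \<omega>"
    note T = exp_mart_le_one[OF assms(2) less_imp_le[OF y] l(1)]
    have int_A: "integrable M (indicator A :: 'a \<Rightarrow> real)"
      by (rule integrable_const_bound[where B = 1]) (auto simp: indicator_def)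
    \<comment> \<open>Markov's inequality: on \<open>A\<close> the exponent \<open>?T\<close> is at least \<open>b z\<close>.\<close>
    have "exp (b * z) * prob A = (\<integral>\<omega>. exp (b * z) * indicator A \<omega> \<partial>M)" by simp
    also have "\<dots> \<le> (\<integral>\<omega>. exp (?T \<omega>) \<partial>M)"
    proof (rule integral_mono[OF _ T(1)])
      fix \<omega>
      show "exp (b * z) * indicator A \<omega> \<le> exp (?T \<omega>)"
      proof (cases "\<omega> \<in> A")
        case True
        then have "z \<le> ?B y \<omega>" "x * ?B y \<omega> \<le> ?S \<omega>"
          using z by (auto simp: A_def pos_le_divide_eq)
        then have "b * z \<le> rate_f x y * ?B y \<omega>" "l * (x * ?B y \<omega>) \<le> l * ?S \<omega>"
          using b l z by (auto intro!: mult_mono mult_left_mono)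
        then have "b * z \<le> ?T \<omega>"
          by (simp add: algebra_simps flip: l(2))
        then show ?thesis using True by simp
      qed simp
    qed (use int_A in simp)
    finally have "exp (b * z) * prob A \<le> 1" using T(2) by simp
    then have "prob A \<le> exp (- (b * z))"
      by (simp add: exp_minus field_simps)
    then show ?thesis by (simp add: A_def b_def)
  qed
  have "?P x y \<le> (INF p\<in>{1<..}. ?K x y p powr (1 / p))" if "0 \<le> x" "0 \<le> y" for x y
    using order_trans[OF chain(1)[OF that] order_trans[OF chain(2,3)[OF that]]] .
  with chain(1,2) tail show ?thesis
    by (intro conjI allI impI; elim conjE) (assumption | rule chain(1,2) tail)+
qed

end
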